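(* For every even $n>6$, there exists an $n\times n$ non-consecutive by king's move Latin square. For every even $n>12$, there exists an $n\times n$ non-consecutive by king's move Latin square that is also anti-king.
   Context: A Latin square of order $n$ is an $n\times n$ table filled with the integers $1,\dots,n$ so that each integer appears exactly once in each row and in each column. Two cells are a king's move apart if they are distinct and are horizontally, vertically or diagonally adjacent (no wrap-around). Two integers are consecutive if they differ by exactly $1$ ($1$ and $n$ are not considered consecutive). A Latin square is non-consecutive by king's move if no two cells a king's move apart contain consecutive integers. A Latin square is anti-king if no two cells a king's move apart contain the same number. *)

theory Defs
  imports Main
begin

text \<open>
  An \<open>n \<times> n\<close> table is a function \<open>L :: nat \<Rightarrow> nat \<Rightarrow> nat\<close>, where \<open>L i j\<close> is the entry in row \<open>i\<close>
  and column \<open>j\<close>. Rows and columns are numbered \<open>1, \<dots>, n\<close>; values of \<open>L\<close> outside this range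
  are irrelevant.
\<close>

definition latin_square :: "nat \<Rightarrow> (nat \<Rightarrow> nat \<Rightarrow> nat) \<Rightarrow> bool" where
  "latin_square n L \<longleftrightarrow>
     (\<forall>i\<in>{1..n}. \<forall>j\<in>{1..n}. L i j \<in> {1..n}) \<and>
     (\<forall>i\<in>{1..n}. \<forall>k\<in>{1..n}. \<exists>!j. j \<in> {1..n} \<and> L i j = k) \<and>
     (\<forall>j\<in>{1..n}. \<forall>k\<in>{1..n}. \<exists>!i. i \<in> {1..n} \<and> L i j = k)"

text \<open>The differences are taken in \<^typ>\<open>int\<close> because subtraction on \<^typ>\<open>nat\<close> truncates.\<close>

definition kings_move :: "nat \<times> nat \<Rightarrow> nat \<times> nat \<Rightarrow> bool" where
  "kings_move c d \<longleftrightarrow>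
     c \<noteq> d \<and> \<bar>int (fst c) - int (fst d)\<bar> \<le> 1 \<and> \<bar>int (snd c) - int (snd d)\<bar> \<le> 1"

definition consecutive :: "nat \<Rightarrow> nat \<Rightarrow> bool" where
  "consecutive a b \<longleftrightarrow> \<bar>int a - int b\<bar> = 1"

definition nonconsecutive_by_kings_move :: "nat \<Rightarrow> (nat \<Rightarrow> nat \<Rightarrow> nat) \<Rightarrow> bool" where
  "nonconsecutive_by_kings_move n L \<longleftrightarrow>
     (\<forall>i\<in>{1..n}. \<forall>j\<in>{1..n}. \<forall>i'\<in>{1..n}. \<forall>j'\<in>{1..n}.
        kings_move (i, j) (i', j') \<longrightarrow> \<not> consecutive (L i j) (L i' j'))"

definition anti_king :: "nat \<Rightarrow> (nat \<Rightarrow> nat \<Rightarrow> nat) \<Rightarrow> bool" where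
  "anti_king n L \<longleftrightarrow>
     (\<forall>i\<in>{1..n}. \<forall>j\<in>{1..n}. \<forall>i'\<in>{1..n}. \<forall>j'\<in>{1..n}.
        kings_move (i, j) (i', j') \<longrightarrow> L i j \<noteq> L i' j')"

end

theory Submission
  imports Defs
begin

text \<open>
  Write \<open>n = 2 m\<close> and visit the residues modulo \<open>n\<close> in the order \<open>0, m, 1, m + 1, 2, \<dots>\<close>: consecutive
  positions differ by \<open>m\<close> or \<open>m - 1\<close>, the residues farthest from \<open>0\<close>. Relabel a Cayley table
  \<open>i + c j\<close> of the cyclic group by these positions, where \<open>c\<close> enumerates the residues. If neighbouring
  values of \<open>c\<close> differ by at most \<open>k\<close> modulo \<open>n\<close>, then cells a king's move apart differ by at most
  \<open>k + 1\<close> before the relabelling, so they are not consecutive once \<open>k + 1 < m - 1\<close>. The choice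
  \<open>c j = j\<close> has \<open>k = 1\<close>. Listing the even residues before the odd ones makes the neighbouring values
  of \<open>c\<close> differ by \<open>2\<close> or \<open>3\<close>, so that moreover no two cells a king's move apart are equal.
\<close>

text \<open>The position, counted from 1, of the residue \<open>x\<close> in the order
  \<open>0, m, 1, m + 1, ...\<close>: residues below \<open>m\<close> take the odd positions, the
  others the even ones.\<close>

definition label :: "int \<Rightarrow> int \<Rightarrow> nat" where
  "label m x = nat (if x < m then 2 * x + 1 else 2 * (x - m) + 2)"

definition cyclic_table :: "int \<Rightarrow> (nat \<Rightarrow> int) \<Rightarrow> nat \<Rightarrow> nat \<Rightarrow> nat" where
  "cyclic_table m c i j = label m ((int i + c j) mod (2 * m))"

lemma int_label:
  assumes "0 \<le> x"
  shows "int (label m x) = (if x < m then 2 * x + 1 else 2 * (x - m) + 2)"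
  using assms by (simp add: label_def)

lemma label_bounds:
  assumes "0 \<le> x" "x < 2 * m"
  shows "1 \<le> label m x" "int (label m x) \<le> 2 * m"
  using assms by (auto simp: label_def)

lemma label_inj:
  assumes "0 \<le> x" "x < 2 * m" "0 \<le> y" "y < 2 * m" "label m x = label m y"
  shows "x = y"
proof -
  have "int (label m x) = int (label m y)"
    using assms by simp
  then show ?thesis
    using assms(1,3) by (auto simp: int_label split: if_splits, presburger+)
qed

text \<open>Labels of two residues in the same half have equal parity, so consecutive labels come
  from opposite halves. With \<open>x < m \<le> y\<close> the labels differ by
  \<open>2 * (x - y) + 2 * m - 1\<close>, which is 1 or -1 only if \<open>y - x\<close> is
  \<open>m - 1\<close> or \<open>m\<close>.\<close>

lemma consecutive_label_far:
  assumes "0 \<le> x" "x < 2 * m" "0 \<le> y" "y < 2 * m" "consecutive (label m x) (label m y)"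
  shows "m - 1 \<le> \<bar>x - y\<bar>" "\<bar>x - y\<bar> \<le> m"
proof -
  have "\<bar>int (label m x) - int (label m y)\<bar> = 1"
    using assms by (simp add: consecutive_def)
  then have "m - 1 \<le> \<bar>x - y\<bar> \<and> \<bar>x - y\<bar> \<le> m"
    using assms(1-4) by (auto simp: int_label abs_if split: if_splits, presburger+)
  then show "m - 1 \<le> \<bar>x - y\<bar>" "\<bar>x - y\<bar> \<le> m"
    by simp_all
qed

text \<open>An injective map of a finite set into itself is onto, so distinctness in each row and
  column suffices.\<close>

lemma latin_squareI:
  assumes range: "\<And>i j. i \<in> {1..n} \<Longrightarrow> j \<in> {1..n} \<Longrightarrow> L i j \<in> {1..n}"
    and row: "\<And>i. i \<in> {1..n} \<Longrightarrow> inj_on (L i) {1..n}"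
    and col: "\<And>j. j \<in> {1..n} \<Longrightarrow> inj_on (\<lambda>i. L i j) {1..n}"
  shows "latin_square n L"
proof -
  have unique: "\<exists>!x. x \<in> {1..n} \<and> f x = k"
    if "inj_on f {1..n}" "f ` {1..n} \<subseteq> {1..n}" "k \<in> {1..n}" for f :: "nat \<Rightarrow> nat" and k
  proof -
    have "f ` {1..n} = {1..n}"
      using that by (intro endo_inj_surj) auto
    then show ?thesis
      using that by (metis (no_types, lifting) imageE inj_onD)
  qed
  show ?thesis
    unfolding latin_square_def
    using range row col by (intro conjI ballI unique) auto
qed

lemma dvd_less_imp_zero:
  fixes a :: int
  assumes "n dvd a" "\<bar>a\<bar> < n"
  shows "a = 0"
  using assms dvd_imp_le_int by force

lemma latin_square_cyclic_table:
  assumes m: "0 < m" "int n = 2 * m"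
    and c: "inj_on (\<lambda>j. c j mod (2 * m)) {1..n}"
  shows "latin_square n (cyclic_table m c)"
proof (rule latin_squareI)
  show "cyclic_table m c i j \<in> {1..n}" for i j
    using label_bounds[of "(int i + c j) mod (2 * m)" m] m by (auto simp: cyclic_table_def)
next
  show "inj_on (cyclic_table m c i) {1..n}" for i
  proof (rule inj_onI)
    fix j j' assume j: "j \<in> {1..n}" "j' \<in> {1..n}"
      and "cyclic_table m c i j = cyclic_table m c i j'"
    then have "(int i + c j) mod (2 * m) = (int i + c j') mod (2 * m)"
      unfolding cyclic_table_def using m by (intro label_inj) auto
    then have "c j mod (2 * m) = c j' mod (2 * m)"
      by (simp add: mod_eq_dvd_iff)
    with c j show "j = j'"
      by (auto dest: inj_onD)
  qed
next
  show "inj_on (\<lambda>i. cyclic_table m c i j) {1..n}" for j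
  proof (rule inj_onI)
    fix i i' assume i: "i \<in> {1..n}" "i' \<in> {1..n}"
      and "cyclic_table m c i j = cyclic_table m c i' j"
    then have "(int i + c j) mod (2 * m) = (int i' + c j) mod (2 * m)"
      unfolding cyclic_table_def using m by (intro label_inj) auto
    then have "2 * m dvd int i - int i'"
      by (simp add: mod_eq_dvd_iff)
    then have "int i - int i' = 0"
      by (rule dvd_less_imp_zero) (use i m in auto)
    then show "i = i'" by simp
  qed
qed

text \<open>Here \<open>d\<close> is a small signed representative of the column step modulo
  \<open>2 * m\<close>. A king's move adds at most 1 for the row, so the residues differ by at most
  \<open>k + 1 \<le> m - 2\<close>, too little for consecutive labels.\<close>

lemma nonconsecutive_cyclic_table:
  assumes m: "0 < m" "int n = 2 * m" and k: "k + 3 \<le> m"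
    and step: "\<And>j j'. \<lbrakk>j \<in> {1..n}; j' \<in> {1..n}; \<bar>int j - int j'\<bar> \<le> 1\<rbrakk>
      \<Longrightarrow> \<exists>d. \<bar>d\<bar> \<le> k \<and> 2 * m dvd c j - c j' - d"
  shows "nonconsecutive_by_kings_move n (cyclic_table m c)"
  unfolding nonconsecutive_by_kings_move_def
proof (intro ballI impI notI)
  fix i j i' j'
  assume j: "j \<in> {1..n}" "j' \<in> {1..n}" and king: "kings_move (i, j) (i', j')"
    and cons: "consecutive (cyclic_table m c i j) (cyclic_table m c i' j')"
  obtain d where d: "\<bar>d\<bar> \<le> k" "2 * m dvd c j - c j' - d"
    using step[OF j] king by (auto simp: kings_move_def)
  define x y e where "x = (int i + c j) mod (2 * m)" and "y = (int i' + c j') mod (2 * m)"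
    and "e = int i - int i' + d"
  have far: "m - 1 \<le> \<bar>x - y\<bar>" "\<bar>x - y\<bar> \<le> m"
    using consecutive_label_far[of x m y] cons m by (auto simp: cyclic_table_def x_def y_def)
  have e: "\<bar>e\<bar> \<le> k + 1"
    using d king by (auto simp: e_def kings_move_def)
  have "2 * m dvd (int i + c j) - (int i' + c j') - e"
    using d by (simp add: e_def algebra_simps)
  then have "2 * m dvd x - y - e"
    unfolding x_def y_def by (simp add: mod_eq_dvd_iff[symmetric] mod_simps)
  \<comment> \<open>The bounds \<open>m\<close> on \<open>x - y\<close> and \<open>m - 2\<close> on
    \<open>e\<close> exclude every nonzero multiple of \<open>2 * m\<close>.\<close>
  then have "x - y - e = 0"
    by (rule dvd_less_imp_zero) (use far e k in linarith)
  with far e k show False by linarith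
qed

text \<open>Between neighbouring columns the row shift is at most 1 in absolute value and cannot
  cancel a column step of size at least 2; the bound on \<open>k\<close> excludes
  wrap-around.\<close>

lemma anti_king_cyclic_table:
  assumes m: "0 < m" "int n = 2 * m" and k: "k + 1 < 2 * m"
    and step: "\<And>j j'. \<lbrakk>j \<in> {1..n}; j' \<in> {1..n}; \<bar>int j - int j'\<bar> = 1\<rbrakk>
      \<Longrightarrow> \<exists>d. 2 \<le> \<bar>d\<bar> \<and> \<bar>d\<bar> \<le> k \<and> 2 * m dvd c j - c j' - d"
  shows "anti_king n (cyclic_table m c)"
  unfolding anti_king_def
proof (intro ballI impI notI)
  fix i j i' j'
  assume i: "i \<in> {1..n}" "i' \<in> {1..n}"
    and j: "j \<in> {1..n}" "j' \<in> {1..n}" and king: "kings_move (i, j) (i', j')"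
    and "cyclic_table m c i j = cyclic_table m c i' j'"
  then have "(int i + c j) mod (2 * m) = (int i' + c j') mod (2 * m)"
    unfolding cyclic_table_def using m by (intro label_inj) auto
  then have dvd: "2 * m dvd (int i + c j) - (int i' + c j')"
    by (simp add: mod_eq_dvd_iff)
  show False
  proof (cases "j = j'")
    case True
    with dvd have "2 * m dvd int i - int i'" by simp
    then have "int i - int i' = 0"
      by (rule dvd_less_imp_zero) (use i m in auto)
    with True king show False by (simp add: kings_move_def)
  next
    case False
    then have "\<bar>int j - int j'\<bar> = 1"
      using king by (auto simp: kings_move_def)
    from step[OF j this] obtain d
      where d: "2 \<le> \<bar>d\<bar>" "\<bar>d\<bar> \<le> k" "2 * m dvd c j - c j' - d"
      by blast
    have near: "\<bar>int i - int i'\<bar> \<le> 1"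
      using king by (auto simp: kings_move_def)
    have "2 * m dvd int i - int i' + d"
      using dvd_diff[OF dvd d(3)] by (simp add: algebra_simps)
    then have "int i - int i' + d = 0"
      by (rule dvd_less_imp_zero) (use near d k in linarith)
    with near d show False by linarith
  qed
qed

text \<open>Columns \<open>1, ..., 2 * m\<close> receive \<open>2, 4, ..., 2 * m\<close> and then
  \<open>3, 5, ..., 2 * m + 1\<close>; the residues 0 and 1 thus appear as \<open>2 * m\<close> and
  \<open>2 * m + 1\<close>.\<close>

definition even_odd :: "int \<Rightarrow> nat \<Rightarrow> int" where
  "even_odd m j = (if int j \<le> m then 2 * int j else 2 * (int j - m) + 1)"

lemma inj_even_odd:
  assumes m: "0 < m" "int n = 2 * m"
  shows "inj_on (\<lambda>j. even_odd m j mod (2 * m)) {1..n}"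
proof (rule inj_onI)
  fix j j' assume j: "j \<in> {1..n}" "j' \<in> {1..n}"
    and "even_odd m j mod (2 * m) = even_odd m j' mod (2 * m)"
  then have dvd: "2 * m dvd even_odd m j - even_odd m j'"
    by (simp add: mod_eq_dvd_iff)
  \<comment> \<open>All values lie between 2 and \<open>2 * m + 1\<close>, so congruent ones are
    equal.\<close>
  have "even_odd m j - even_odd m j' = 0"
    by (rule dvd_less_imp_zero[OF dvd]) (use j m in \<open>auto simp: even_odd_def\<close>)
  moreover have "even (even_odd m j - even_odd m j')"
    using dvd by (rule dvd_trans[rotated]) simp
  ultimately show "j = j'"
    by (auto simp: even_odd_def split: if_splits, presburger+)
qed

lemma even_odd_step:
  assumes "\<bar>int j - int j'\<bar> = 1"
  shows "\<exists>d. 2 \<le> \<bar>d\<bar> \<and> \<bar>d\<bar> \<le> 3 \<and> 2 * m dvd even_odd m j - even_odd m j' - d"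
proof -
  have up: "\<exists>d. 2 \<le> d \<and> d \<le> 3 \<and> 2 * m dvd even_odd m b - even_odd m a - d"
    if "int b = int a + 1" for a b
  proof (cases "int a = m")
    \<comment> \<open>At the seam the value drops from \<open>2 * m\<close> to 3, which is a step of
      3 modulo \<open>2 * m\<close>.\<close>
    case True
    with that show ?thesis
      by (intro exI[of _ 3]) (simp add: even_odd_def)
  next
    case False
    with that show ?thesis
      by (intro exI[of _ 2]) (auto simp: even_odd_def)
  qed
  consider "int j = int j' + 1" | "int j' = int j + 1"
    using assms by linarith
  then show ?thesis
  proof cases
    case 1
    from up[OF this] show ?thesis by force
  next
    case 2
    from up[OF this] obtain d where d: "2 \<le> d" "d \<le> 3" "2 * m dvd even_odd m j' - even_odd m j - d"
      by blast
    then have "2 * m dvd even_odd m j - even_odd m j' - (- d)"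
      by (subst dvd_minus_iff[symmetric]) (simp add: algebra_simps)
    with d show ?thesis by (intro exI[of _ "- d"]) auto
  qed
qed

theorem theorem4:
  shows "(\<forall>n::nat. even n \<and> n > 6 \<longrightarrow>
            (\<exists>L. latin_square n L \<and> nonconsecutive_by_kings_move n L)) \<and>
         (\<forall>n::nat. even n \<and> n > 12 \<longrightarrow>
            (\<exists>L. latin_square n L \<and> nonconsecutive_by_kings_move n L \<and> anti_king n L))"
proof (intro conjI allI impI)
  fix n :: nat assume n: "even n \<and> n > 6"
  then obtain m where "n = 2 * m" by blast
  \<comment> \<open>The last fact is \<open>k + 3 \<le> m\<close> for the step bound
    \<open>k = 1\<close>.\<close>
  with n have m: "0 < int m" "int n = 2 * int m" "1 + 3 \<le> int m" by auto
  have "inj_on (\<lambda>j. int j mod (2 * int m)) {1..n}"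
  proof (rule inj_onI)
    fix j j' assume j: "j \<in> {1..n}" "j' \<in> {1..n}"
      and "int j mod (2 * int m) = int j' mod (2 * int m)"
    then have "2 * int m dvd int j - int j'"
      by (simp add: mod_eq_dvd_iff)
    then have "int j - int j' = 0"
      by (rule dvd_less_imp_zero) (use j m in auto)
    then show "j = j'" by simp
  qed
  then have "latin_square n (cyclic_table (int m) int)"
    by (rule latin_square_cyclic_table[OF m(1,2)])
  moreover have "nonconsecutive_by_kings_move n (cyclic_table (int m) int)"
    \<comment> \<open>The witness for \<open>d\<close> is \<open>int j - int j'\<close>
      itself.\<close>
    by (rule nonconsecutive_cyclic_table[OF m]) force
  ultimately show "\<exists>L. latin_square n L \<and> nonconsecutive_by_kings_move n L"
    by blast
next
  fix n :: nat assume n: "even n \<and> n > 12"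
  then obtain m where "n = 2 * m" by blast
  \<comment> \<open>Now \<open>k = 3\<close>, because of the step at the seam of
    \<open>even_odd\<close>.\<close>
  with n have m: "0 < int m" "int n = 2 * int m" "3 + 3 \<le> int m" by auto
  let ?L = "cyclic_table (int m) (even_odd (int m))"
  have "latin_square n ?L"
    using m by (intro latin_square_cyclic_table inj_even_odd)
  moreover have "nonconsecutive_by_kings_move n ?L"
  proof (rule nonconsecutive_cyclic_table[OF m])
    fix j j' :: nat assume near: "\<bar>int j - int j'\<bar> \<le> 1"
    show "\<exists>d. \<bar>d\<bar> \<le> 3 \<and> 2 * int m dvd even_odd (int m) j - even_odd (int m) j' - d"
    proof (cases "j = j'")
      case True
      then show ?thesis by (intro exI[of _ 0]) simp
    next
      case False
      with near have "\<bar>int j - int j'\<bar> = 1" by linarith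
      from even_odd_step[OF this] show ?thesis by blast
    qed
  qed
  moreover have "anti_king n ?L"
    by (rule anti_king_cyclic_table[OF m(1,2), of 3]) (use m even_odd_step in auto)
  ultimately show "\<exists>L. latin_square n L \<and> nonconsecutive_by_kings_move n L \<and> anti_king n L"
    by blast
qed

end
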